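(* Let $R$ be a Noetherian integral domain of (Krull) dimension $1$. Then any radical ideal in $R[X]$ is power stable.
   Context: All rings are commutative with identity. An ideal $I$ of $R[X]$ is called power stable if $I^t\cap R=(I\cap R)^t$ for all $t\geq 1$. *)

theory Defs
  imports "HOL-Algebra.Algebra" "HOL-Library.Extended_Nat"
begin

text \<open>
  The length of a chain of primes is the number of strict inclusions. The zero ring has no prime
  ideals and is assigned dimension \<open>0\<close>; for domains this convention plays no role.
\<close>

definition krull_dim :: "('a, 'b) ring_scheme \<Rightarrow> enat" where
  "krull_dim R = Sup {enat n | n. \<exists>P :: nat \<Rightarrow> 'a set.
     (\<forall>i\<le>n. primeideal (P i) R) \<and> (\<forall>i<n. P i \<subset> P (Suc i))}"

definition ideal_radical :: "('a, 'b) ring_scheme \<Rightarrow> 'a set \<Rightarrow> 'a set" where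
  "ideal_radical R I = {x \<in> carrier R. \<exists>n::nat. n \<ge> 1 \<and> x [^]\<^bsub>R\<^esub> n \<in> I}"

definition radical_ideal :: "'a set \<Rightarrow> ('a, 'b) ring_scheme \<Rightarrow> bool" where
  "radical_ideal I R \<longleftrightarrow> ideal I R \<and> ideal_radical R I = I"

text \<open>
  Powers are taken in the library's multiplicative monoid of ideals under \<^const>\<open>ideal_prod\<close>,
  so the zeroth power is the whole ring.
\<close>

definition ideal_pow :: "('a, 'b) ring_scheme \<Rightarrow> 'a set \<Rightarrow> nat \<Rightarrow> 'a set" where
  "ideal_pow R I t = I [^]\<^bsub>ideals_set R\<^esub> t"

text \<open>
  The intersection of \<open>I\<close> with \<open>R\<close>, where \<open>R\<close> is identified with the constant polynomials
  of \<^term>\<open>UP R\<close>.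
\<close>

definition contraction :: "('a, 'b) ring_scheme \<Rightarrow> (nat \<Rightarrow> 'a) set \<Rightarrow> 'a set" where
  "contraction R I = {a \<in> carrier R. monom (UP R) a 0 \<in> I}"

definition power_stable :: "('a, 'b) ring_scheme \<Rightarrow> (nat \<Rightarrow> 'a) set \<Rightarrow> bool" where
  "power_stable R I \<longleftrightarrow> ideal I (UP R) \<and>
     (\<forall>t\<ge>1. contraction R (ideal_pow (UP R) I t) = ideal_pow R (contraction R I) t)"

end

theory Submission
  imports Defs
begin

text \<open>
  Let \<open>J\<close> be the contraction of \<open>I\<close> and \<open>a\<close> a constant in the \<open>t\<close>-th power of \<open>I\<close>; the case \<open>J = 0\<close> is
  clear. If the colon ideal of \<open>a\<close> into the \<open>t\<close>-th power of \<open>J\<close> is proper, it lies in a maximal ideal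
  \<open>M\<close>, which contains \<open>J\<close>. As \<open>J\<close> is radical and nonzero in dimension one, some \<open>b\<close> outside \<open>M\<close>
  multiplies \<open>M\<close> into \<open>J\<close>. Therefore \<open>I + M[X]\<close> is proper, so \<open>I\<close> is contained in \<open>M[X] + (f)\<close> for some
  monic \<open>f\<close> of positive degree. Then \<open>a\<close> is congruent to a multiple of \<open>f\<close> modulo the \<open>t\<close>-th power
  of \<open>M\<close>, and comparing degrees puts \<open>a\<close> into that power. Now the \<open>t\<close>-th power of \<open>b\<close> multiplies \<open>a\<close>
  into the \<open>t\<close>-th power of \<open>J\<close>, so it lies in the colon ideal, hence in \<open>M\<close>, a contradiction.
\<close>

subsection \<open>Ideals of Noetherian rings\<close>

text \<open>In a Noetherian ring a nonempty chain of ideals contains its own union, so Zorn's lemma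
  applies to any nonempty family of ideals, whether or not it is closed under unions.\<close>

lemma (in noetherian_ring) exists_maximal_among:
  assumes "S \<noteq> {}" "\<And>I. I \<in> S \<Longrightarrow> ideal I R"
  shows "\<exists>M\<in>S. \<forall>N\<in>S. M \<subseteq> N \<longrightarrow> N = M"
proof (rule subset_Zorn_nonempty[OF assms(1)])
  fix C assume C: "C \<noteq> {}" "subset.chain S C"
  then have "subset.chain {I. ideal I R} C"
    using assms(2) unfolding pred_on.chain_def by auto
  then have "\<Union>C \<in> C" using ideal_chain_is_trivial C(1) by blast
  then show "\<Union>C \<in> S" using C(2) unfolding pred_on.chain_def by auto
qed

lemma (in noetherian_ring) exists_maximalideal_above:
  assumes J: "ideal J R" "J \<noteq> carrier R"
  shows "\<exists>M. maximalideal M R \<and> J \<subseteq> M"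
proof -
  let ?S = "{I. ideal I R \<and> J \<subseteq> I \<and> I \<noteq> carrier R}"
  have "?S \<noteq> {}" using J by auto
  then have "\<exists>M\<in>?S. \<forall>N\<in>?S. M \<subseteq> N \<longrightarrow> N = M"
    by (rule exists_maximal_among) simp
  then obtain M where M: "M \<in> ?S" and max: "\<forall>N\<in>?S. M \<subseteq> N \<longrightarrow> N = M"
    by (elim bexE)
  have "maximalideal M R"
  proof (rule maximalidealI)
    fix N assume "ideal N R" "M \<subseteq> N" "N \<subseteq> carrier R"
    then show "N = M \<or> N = carrier R" using bspec[OF max, of N] M by blast
  qed (use M in auto)
  then show ?thesis using M by blast
qed

lemma (in cring) ideal_add_cgenidealD:
  assumes "y \<in> I <+>\<^bsub>R\<^esub> PIdl a"
  shows "\<exists>m\<in>I. \<exists>r\<in>carrier R. y = m \<oplus> r \<otimes> a"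
  using assms unfolding set_add_def' cgenideal_def by auto

lemma (in ring) ideals_subset_set_add:
  assumes "ideal I R" "ideal J R"
  shows "I \<subseteq> I <+>\<^bsub>R\<^esub> J" "J \<subseteq> I <+>\<^bsub>R\<^esub> J"
proof -
  interpret I: ideal I R by fact
  interpret J: ideal J R by fact
  show "I \<subseteq> I <+>\<^bsub>R\<^esub> J"
  proof
    fix x assume x: "x \<in> I"
    then have "x = x \<oplus> \<zero>" by simp
    then show "x \<in> I <+>\<^bsub>R\<^esub> J" unfolding set_add_def' using x J.zero_closed by blast
  qed
  show "J \<subseteq> I <+>\<^bsub>R\<^esub> J"
  proof
    fix x assume x: "x \<in> J"
    then have "x = \<zero> \<oplus> x" by simp
    then show "x \<in> I <+>\<^bsub>R\<^esub> J" unfolding set_add_def' using x I.zero_closed by blast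
  qed
qed

lemma (in cring) ideal_add_cgenideal:
  assumes "ideal I R" "a \<in> carrier R"
  shows "ideal (I <+>\<^bsub>R\<^esub> PIdl a) R" "I \<subseteq> I <+>\<^bsub>R\<^esub> PIdl a" "a \<in> I <+>\<^bsub>R\<^esub> PIdl a"
proof -
  note Q = cgenideal_ideal[OF assms(2)]
  show "ideal (I <+>\<^bsub>R\<^esub> PIdl a) R" using add_ideals[OF assms(1) Q] .
  show "I \<subseteq> I <+>\<^bsub>R\<^esub> PIdl a" using ideals_subset_set_add(1)[OF assms(1) Q] .
  show "a \<in> I <+>\<^bsub>R\<^esub> PIdl a"
    using ideals_subset_set_add(2)[OF assms(1) Q] cgenideal_self[OF assms(2)] by blast
qed

text \<open>Krull's argument: take \<open>M\<close> maximal among the ideals above \<open>J\<close>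
  that miss \<open>S\<close>. If \<open>a\<close> and \<open>b\<close> lie outside \<open>M\<close>,
  then both \<open>M + (a)\<close> and \<open>M + (b)\<close> meet \<open>S\<close>. The product of
  two such meeting elements is again in \<open>S\<close>, but it would lie in \<open>M\<close> if
  \<open>a b\<close> did.\<close>

lemma (in noetherian_ring) exists_primeideal_avoiding:
  assumes "cring R" and J: "ideal J R" "J \<inter> S = {}"
    and S: "S \<subseteq> carrier R" "\<one> \<in> S" "\<And>x y. x \<in> S \<Longrightarrow> y \<in> S \<Longrightarrow> x \<otimes> y \<in> S"
  shows "\<exists>P. primeideal P R \<and> J \<subseteq> P \<and> P \<inter> S = {}"
proof -
  interpret cring R by fact
  let ?F = "{I. ideal I R \<and> J \<subseteq> I \<and> I \<inter> S = {}}"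
  have "?F \<noteq> {}" using J by auto
  then have "\<exists>M\<in>?F. \<forall>N\<in>?F. M \<subseteq> N \<longrightarrow> N = M"
    by (rule exists_maximal_among) simp
  then obtain M where MF: "M \<in> ?F" and max: "\<forall>N\<in>?F. M \<subseteq> N \<longrightarrow> N = M"
    by (elim bexE)
  from MF have M: "ideal M R" "J \<subseteq> M" "M \<inter> S = {}" by simp_all
  interpret M: ideal M R by fact
  have meets: "\<exists>m\<in>M. \<exists>r\<in>carrier R. m \<oplus> r \<otimes> a \<in> S" if a: "a \<in> carrier R" "a \<notin> M" for a
  proof -
    note N = ideal_add_cgenideal[OF M(1) a(1)]
    have "M <+>\<^bsub>R\<^esub> PIdl a \<notin> ?F" using bspec[OF max, of "M <+>\<^bsub>R\<^esub> PIdl a"] N(2,3) a(2) by blast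
    then have "(M <+>\<^bsub>R\<^esub> PIdl a) \<inter> S \<noteq> {}" using N(1,2) M(2) by auto
    then obtain y where y: "y \<in> M <+>\<^bsub>R\<^esub> PIdl a" "y \<in> S" by blast
    show ?thesis using ideal_add_cgenidealD[OF y(1)] y(2) by blast
  qed
  have "primeideal M R"
  proof (rule primeidealI[OF M(1) \<open>cring R\<close>])
    show "carrier R \<noteq> M" using M(3) S(2) by auto
    fix a b assume ab: "a \<in> carrier R" "b \<in> carrier R" "a \<otimes> b \<in> M"
    show "a \<in> M \<or> b \<in> M"
    proof (rule ccontr)
      assume "\<not> (a \<in> M \<or> b \<in> M)"
      then obtain m r n s where m: "m \<in> M" "r \<in> carrier R" "m \<oplus> r \<otimes> a \<in> S"
        and n: "n \<in> M" "s \<in> carrier R" "n \<oplus> s \<otimes> b \<in> S"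
        using meets ab by meson
      have mn: "m \<in> carrier R" "n \<in> carrier R" using m n M.Icarr by auto
      have "(m \<oplus> r \<otimes> a) \<otimes> (n \<oplus> s \<otimes> b)
          = m \<otimes> (n \<oplus> s \<otimes> b) \<oplus> ((r \<otimes> a) \<otimes> n \<oplus> (r \<otimes> s) \<otimes> (a \<otimes> b))"
        using mn m(2) n(2) ab by algebra
      moreover have "\<dots> \<in> M"
        by (intro M.a_closed M.I_r_closed[OF m(1)] M.I_l_closed[OF n(1)] M.I_l_closed[OF ab(3)])
          (use m(2) n(2) mn ab in simp_all)
      ultimately show False using S(3)[OF m(3) n(3)] M(3) by auto
    qed
  qed
  then show ?thesis using M by blast
qed

lemma (in cring) colon_ideal:
  assumes "ideal K R" "a \<in> carrier R"
  shows "ideal {x \<in> carrier R. a \<otimes> x \<in> K} R"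
proof -
  interpret K: ideal K R by fact
  show ?thesis
  proof (rule idealI[OF ring_axioms])
    show "subgroup {x \<in> carrier R. a \<otimes> x \<in> K} (add_monoid R)"
    proof (rule add.subgroupI)
      have "a \<otimes> \<zero> \<in> K" using assms(2) by simp
      then show "{x \<in> carrier R. a \<otimes> x \<in> K} \<noteq> {}" by blast
    qed (use assms(2) in \<open>auto simp: r_distr r_minus\<close>)
    fix x y assume "x \<in> {x \<in> carrier R. a \<otimes> x \<in> K}" "y \<in> carrier R"
    moreover from this have "a \<otimes> (y \<otimes> x) = y \<otimes> (a \<otimes> x)" "a \<otimes> (x \<otimes> y) = y \<otimes> (a \<otimes> x)"
      using assms(2) by (auto simp: m_ac)
    ultimately show "y \<otimes> x \<in> {x \<in> carrier R. a \<otimes> x \<in> K}" "x \<otimes> y \<in> {x \<in> carrier R. a \<otimes> x \<in> K}"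
      by (auto intro: K.I_l_closed)
  qed
qed

lemma krull_dim_ge_two:
  assumes "primeideal P R" "primeideal Q R" "primeideal N R" "P \<subset> Q" "Q \<subset> N"
  shows "krull_dim R \<ge> 2"
proof -
  let ?F = "\<lambda>i::nat. if i = 0 then P else if i = 1 then Q else N"
  have "\<forall>i\<le>2. primeideal (?F i) R" "\<forall>i<2. ?F i \<subset> ?F (Suc i)"
    using assms by (auto simp: less_2_cases_iff)
  then have "enat 2 \<le> krull_dim R"
    unfolding krull_dim_def by (intro Sup_upper CollectI exI[of _ 2] exI[of _ ?F] conjI refl) simp_all
  then show ?thesis by (simp add: numeral_eq_enat)
qed

text \<open>Equivalently, \<open>J\<close> and \<open>M\<close> have the same extension to the localization at \<open>M\<close>.\<close>

lemma (in noetherian_domain) radical_ideal_locally_maximal: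
  assumes dim: "krull_dim R \<le> 1" and J: "radical_ideal J R" "J \<noteq> {\<zero>}" "J \<subseteq> M"
    and M: "primeideal M R"
  shows "\<exists>b\<in>carrier R - M. \<forall>x\<in>M. b \<otimes> x \<in> J"
proof -
  interpret J: ideal J R using J(1) by (simp add: radical_ideal_def)
  interpret M: primeideal M R by fact
  have rad: "x \<in> J" if "x \<in> carrier R" "x [^] (n::nat) \<in> J" "n \<ge> 1" for x n
    using J(1) that unfolding radical_ideal_def ideal_radical_def by blast
  \<comment> \<open>First a multiplier \<open>s\<close> for each single element of \<open>M\<close>;
    a common one is built from finitely many generators below.\<close>
  have elem: "\<exists>s\<in>carrier R - M. s \<otimes> x \<in> J" if x: "x \<in> M" for x
  proof -
    have xc: "x \<in> carrier R" using x by auto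
    \<comment> \<open>This is the multiplicative set generated by \<open>x\<close> and the
      complement of \<open>M\<close>. A prime that avoids it lies inside \<open>M\<close> and does
      not contain \<open>x\<close>. If it also contains the nonzero ideal \<open>J\<close>, it sits
      strictly between 0 and \<open>M\<close>, which dimension one forbids.\<close>
    let ?S = "{s \<otimes> x [^] n | s n::nat. s \<in> carrier R - M}"
    have "J \<inter> ?S \<noteq> {}"
    proof
      assume disj: "J \<inter> ?S = {}"
      have one: "\<one> \<notin> M" using M.I_notcarr M.one_imp_carrier by auto
      have mem: "s \<otimes> x [^] n \<in> ?S" if "s \<in> carrier R - M" for s and n::nat
        using that by blast
      have "\<one> \<in> ?S" using mem[of \<one> 0] one by simp
      moreover have "y \<otimes> z \<in> ?S" if yz: "y \<in> ?S" "z \<in> ?S" for y z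
      proof -
        obtain s n t k where st: "y = s \<otimes> x [^] (n::nat)" "s \<in> carrier R - M"
          "z = t \<otimes> x [^] (k::nat)" "t \<in> carrier R - M" using yz by blast
        then have "y \<otimes> z = (s \<otimes> t) \<otimes> (x [^] n \<otimes> x [^] k)"
          using xc by (simp add: m_ac)
        then have eq: "y \<otimes> z = (s \<otimes> t) \<otimes> x [^] (n + k)"
          using xc by (simp add: nat_pow_mult)
        have "s \<otimes> t \<in> carrier R - M" using st M.I_prime by auto
        then show ?thesis unfolding eq by (rule mem)
      qed
      moreover have "?S \<subseteq> carrier R" using xc by auto
      ultimately obtain P where P: "primeideal P R" "J \<subseteq> P" "P \<inter> ?S = {}"
        using exists_primeideal_avoiding[OF is_cring J.is_ideal disj] by blast
      interpret P: primeideal P R by fact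
      have "P \<subseteq> M"
      proof
        fix s assume s: "s \<in> P"
        show "s \<in> M"
        proof (rule ccontr)
          assume "s \<notin> M"
          then show False using mem[of s 0] P(3) s by auto
        qed
      qed
      moreover have "x \<notin> P" using mem[of \<one> 1] one xc P(3) by auto
      moreover have "{\<zero>} \<subset> P" using J(2) P(2) J.zero_closed by auto
      ultimately have "krull_dim R \<ge> 2"
        using krull_dim_ge_two[OF zeroprimeideal P(1) M] x by blast
      then have "(2::enat) \<le> 1" using dim order_trans by blast
      then show False by simp
    qed
    then obtain s n where s: "s \<in> carrier R - M" "s \<otimes> x [^] (n::nat) \<in> J" by blast
    \<comment> \<open>This power is a multiple of \<open>s x^n\<close>, hence lies in the radical
      ideal \<open>J\<close>. The exponent \<open>Suc n\<close> is positive even for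
      \<open>n = 0\<close>, as the definition of the radical demands.\<close>
    have "(s \<otimes> x) [^] Suc n = s [^] n \<otimes> x \<otimes> s \<otimes> x [^] n"
      using s xc by (simp add: nat_pow_distrib m_ac)
    also have "\<dots> = (s [^] n \<otimes> x) \<otimes> (s \<otimes> x [^] n)"
      using s xc by (simp add: m_assoc)
    also have "\<dots> \<in> J" by (rule J.I_l_closed) (use s xc in simp_all)
    finally have "s \<otimes> x \<in> J" by (rule rad[rotated]) (use s xc in simp_all)
    then show ?thesis using s by blast
  qed
  \<comment> \<open>The product of the multipliers of finitely many generators works for all
    generators at once. The colon ideal of \<open>J\<close> by that product then contains the
    generators, hence all of \<open>M\<close>.\<close>
  obtain S where S: "S \<subseteq> carrier R" "finite S" "M = Idl S"
    using finetely_gen[OF M.is_ideal] by blast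
  have "finite T \<Longrightarrow> T \<subseteq> M \<Longrightarrow> \<exists>b\<in>carrier R - M. \<forall>x\<in>T. b \<otimes> x \<in> J" for T
  proof (induction T rule: finite_induct)
    case empty
    then show ?case using M.I_notcarr M.one_imp_carrier by auto
  next
    case (insert x T)
    then obtain b where b: "b \<in> carrier R - M" "\<forall>y\<in>T. b \<otimes> y \<in> J" by auto
    obtain s where s: "s \<in> carrier R - M" "s \<otimes> x \<in> J" using elem insert by blast
    have "s \<otimes> b \<in> carrier R - M" using s b M.I_prime by auto
    moreover have "s \<otimes> b \<otimes> y \<in> J" if y: "y \<in> insert x T" for y
    proof (cases "y = x")
      case True
      have "s \<otimes> b \<otimes> x = b \<otimes> (s \<otimes> x)" using s b insert M.Icarr by (simp add: m_ac)
      then show ?thesis using True b s J.I_l_closed by simp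
    next
      case False
      then have "y \<in> T" using y by auto
      then have "s \<otimes> b \<otimes> y = s \<otimes> (b \<otimes> y)" using s b insert M.Icarr by (auto simp: m_assoc)
      then show ?thesis using \<open>y \<in> T\<close> b s J.I_l_closed by simp
    qed
    ultimately show ?case by blast
  qed
  then obtain b where b: "b \<in> carrier R - M" "\<forall>x\<in>S. b \<otimes> x \<in> J"
    using S genideal_self by metis
  then have "Idl S \<subseteq> {x \<in> carrier R. b \<otimes> x \<in> J}"
    using S(1) by (intro genideal_minimal colon_ideal J.is_ideal) auto
  then show ?thesis using b S(3) by blast
qed

section \<open>Powers of ideals and residues modulo a maximal ideal\<close>

lemma ideal_pow_0: "ideal_pow R K 0 = carrier R"
  by (simp add: ideal_pow_def nat_pow_def ideals_set_def)

lemma ideal_pow_Suc: "ideal_pow R K (Suc t) = ideal_prod R (ideal_pow R K t) K"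
  by (simp add: ideal_pow_def nat_pow_def ideals_set_def)

lemma (in ring) ideal_ideal_pow:
  assumes "ideal K R"
  shows "ideal (ideal_pow R K t) R"
  by (induction t) (simp_all add: ideal_pow_0 ideal_pow_Suc oneideal ideal_prod_is_ideal assms)

lemma (in ring) ideal_pow_subset:
  assumes "ideal K R" "t \<ge> 1"
  shows "ideal_pow R K t \<subseteq> K"
proof -
  obtain s where "t = Suc s" using assms(2) by (cases t) auto
  then show ?thesis
    using ideal_prod_inter[OF ideal_ideal_pow[OF assms(1)] assms(1), of s] by (auto simp: ideal_pow_Suc)
qed

text \<open>Each of the \<open>t\<close> factors from \<open>K\<close> in a product absorbs one of
  the \<open>t\<close> copies of \<open>b\<close>, and sums are handled by distributivity.\<close>

lemma (in cring) ideal_pow_scale: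
  assumes K: "ideal K R" and b: "b \<in> carrier R" and J: "ideal J R" "\<And>x. x \<in> K \<Longrightarrow> b \<otimes> x \<in> J"
    and "x \<in> ideal_pow R K t"
  shows "b [^] t \<otimes> x \<in> ideal_pow R J t"
  using assms(5)
proof (induction t arbitrary: x)
  case 0
  then show ?case using b by (simp add: ideal_pow_0)
next
  case (Suc t)
  have carr: "ideal_pow R K t \<subseteq> carrier R" "ideal_prod R (ideal_pow R K t) K \<subseteq> carrier R" "K \<subseteq> carrier R"
    using ideal.Icarr[OF ideal_ideal_pow[OF K, of t]] ideal_prod_in_carrier[OF ideal_ideal_pow[OF K, of t] K]
      ideal.Icarr[OF K] by auto
  from Suc.prems[unfolded ideal_pow_Suc] show ?case unfolding ideal_pow_Suc
  proof (induction rule: ideal_prod.induct)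
    case (prod i j)
    then have "b [^] Suc t \<otimes> (i \<otimes> j) = (b [^] t \<otimes> i) \<otimes> (b \<otimes> j)"
      using b carr by (simp add: m_ac subset_iff)
    then show ?case using ideal_prod.prod[OF Suc.IH[OF prod(1)] J(2)[OF prod(2)]] by metis
  next
    case (sum s1 s2)
    then have "b [^] Suc t \<otimes> (s1 \<oplus> s2) = b [^] Suc t \<otimes> s1 \<oplus> b [^] Suc t \<otimes> s2"
      using b carr by (intro r_distr) auto
    then show ?case using ideal_prod.sum[OF sum(3,4)] by simp
  qed
qed

text \<open>By maximality \<open>M + (u)\<close> is the whole ring, and an expression
  \<open>1 = m + r u\<close> provides the inverse. It serves to normalize leading coefficients
  modulo \<open>M\<close>.\<close>

lemma (in cring) inverse_mod_maximalideal:
  assumes M: "maximalideal M R" and u: "u \<in> carrier R" "u \<notin> M"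
  shows "\<exists>v\<in>carrier R. v \<otimes> u \<ominus> \<one> \<in> M"
proof -
  interpret M: maximalideal M R by fact
  note N = ideal_add_cgenideal[OF M.is_ideal u(1)]
  interpret N: ideal "M <+>\<^bsub>R\<^esub> PIdl u" R using N(1) .
  have "M <+>\<^bsub>R\<^esub> PIdl u = carrier R"
    using M.I_maximal[OF N(1,2)] N(3) u(2) N.Icarr by blast
  then obtain m r where m: "m \<in> M" "r \<in> carrier R" "\<one> = m \<oplus> r \<otimes> u"
    using ideal_add_cgenidealD[of \<one> M u] by auto
  have "m \<in> carrier R" using m(1) M.Icarr by blast
  then have "r \<otimes> u \<ominus> (m \<oplus> r \<otimes> u) = \<ominus> m"
    using u(1) m(2) by algebra
  then have "r \<otimes> u \<ominus> \<one> = \<ominus> m" using m(3) by simp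
  then show ?thesis using m(1,2) M.a_inv_closed by metis
qed

lemma nat_pow_mem_ideal_pow:
  assumes "monoid R" "x \<in> J" "J \<subseteq> carrier R"
  shows "x [^]\<^bsub>R\<^esub> t \<in> ideal_pow R J t"
proof (induction t)
  case (Suc t)
  then show ?case using assms by (simp add: monoid.nat_pow_Suc ideal_pow_Suc ideal_prod.prod)
qed (simp add: ideal_pow_0 monoid.nat_pow_0[OF assms(1)] monoid.one_closed[OF assms(1)])

lemma (in primeideal) nat_pow_memD:
  assumes "x \<in> carrier R" "x [^] (n::nat) \<in> I"
  shows "x \<in> I"
  using assms(2)
proof (induction n)
  case 0
  then show ?case using I_notcarr one_imp_carrier by auto
next
  case (Suc n)
  then show ?case using I_prime[of "x [^] n" x] assms(1) by auto
qed

lemma (in ideal) finsum_mem: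
  assumes "\<And>i. i \<in> A \<Longrightarrow> f i \<in> I"
  shows "(\<Oplus>i\<in>A. f i) \<in> I"
  using assms
proof (induction A rule: infinite_finite_induct)
  case (insert x A)
  then have "f \<in> A \<rightarrow> carrier R" "f x \<in> carrier R" using Icarr by blast+
  then show ?case using insert by (simp add: finsum_insert)
qed (simp_all add: finsum_infinite)

lemma (in ideal) mem_of_add_mem:
  assumes "x \<in> carrier R" "y \<in> I" "x \<oplus> y \<in> I"
  shows "x \<in> I"
proof -
  have "x \<oplus> y \<oplus> \<ominus> y \<in> I"
    using additive_subgroup.a_closed[OF is_additive_subgroup assms(3)]
      additive_subgroup.a_inv_closed[OF is_additive_subgroup assms(2)] by blast
  moreover have "x \<oplus> y \<oplus> \<ominus> y = x" using assms Icarr by (simp add: a_assoc r_neg)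
  ultimately show ?thesis by simp
qed

subsection \<open>Ideals of polynomial rings\<close>

text \<open>
  This is the ideal \<open>K[X]\<close> of polynomials. Inside the locale \<open>UP_cring\<close> the plain names \<open>coeff\<close> and \<open>monom\<close>
  denote operations on list polynomials, hence the qualified names below.
\<close>

definition coeffs_in :: "('a, 'b) ring_scheme \<Rightarrow> 'a set \<Rightarrow> (nat \<Rightarrow> 'a) set" where
  "coeffs_in R K = {p \<in> carrier (UP R). \<forall>n. coeff (UP R) p n \<in> K}"

context UP_cring
begin

lemma mem_coeffs_in: "p \<in> coeffs_in R K \<longleftrightarrow> p \<in> carrier P \<and> (\<forall>n. up_ring.coeff P p n \<in> K)"
  unfolding coeffs_in_def P_def by simp

lemma ex_poly_coeffs:
  assumes "\<And>n. h n \<in> carrier R" "\<And>n. n > d \<Longrightarrow> h n = \<zero>"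
  shows "\<exists>p\<in>carrier P. \<forall>n. up_ring.coeff P p n = h n"
proof -
  have "h \<in> up R" using assms by auto
  then have "h \<in> carrier P" "\<forall>n. up_ring.coeff P h n = h n" unfolding P_def UP_def by simp_all
  then show ?thesis by blast
qed

lemma coeffs_in_ideal:
  assumes "ideal K R"
  shows "ideal (coeffs_in R K) P"
proof -
  interpret K: ideal K R by fact
  show ?thesis
  proof (rule idealI[OF P.ring_axioms])
    show "subgroup (coeffs_in R K) (add_monoid P)"
    proof (rule P.add.subgroupI)
      show "coeffs_in R K \<noteq> {}" using mem_coeffs_in[of "\<zero>\<^bsub>P\<^esub>" K] by auto
    qed (auto simp: mem_coeffs_in)
    fix p q assume p: "p \<in> coeffs_in R K" and q: "q \<in> carrier P"
    then have pc: "p \<in> carrier P" "\<And>n. up_ring.coeff P p n \<in> K" by (simp_all add: mem_coeffs_in)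
    show "p \<otimes>\<^bsub>P\<^esub> q \<in> coeffs_in R K"
      using pc q by (auto simp: mem_coeffs_in intro!: K.finsum_mem K.I_r_closed)
    then show "q \<otimes>\<^bsub>P\<^esub> p \<in> coeffs_in R K" using pc(1) q P.m_comm by metis
  qed
qed

lemma mult_mem_coeffs_in_ideal_prod:
  assumes "ideal K R" "ideal L R" "p \<in> coeffs_in R K" "q \<in> coeffs_in R L"
  shows "p \<otimes>\<^bsub>P\<^esub> q \<in> coeffs_in R (ideal_prod R K L)"
proof -
  interpret KL: ideal "ideal_prod R K L" R using R.ideal_prod_is_ideal assms(1,2) .
  show ?thesis using assms(3,4)
    by (auto simp: mem_coeffs_in intro!: KL.finsum_mem ideal_prod.prod)
qed

text \<open>The index found is the degree of \<open>p\<close> modulo \<open>K\<close>. It exists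
  because the coefficients beyond the degree of \<open>p\<close> are 0, and thus in
  \<open>K\<close>.\<close>

lemma ex_top_coeff_not_in:
  assumes "p \<in> carrier P" "p \<notin> coeffs_in R K" "\<zero> \<in> K"
  shows "\<exists>n. up_ring.coeff P p n \<notin> K \<and> (\<forall>k>n. up_ring.coeff P p k \<in> K)"
proof -
  obtain n where n: "up_ring.coeff P p n \<notin> K" using assms(1,2) by (auto simp: mem_coeffs_in)
  have bnd: "\<forall>k. up_ring.coeff P p k \<notin> K \<longrightarrow> k \<le> deg R p"
    using deg_aboveD[OF _ assms(1)] assms(3) by (metis not_le)
  let ?n = "GREATEST k. up_ring.coeff P p k \<notin> K"
  have "up_ring.coeff P p ?n \<notin> K" using GreatestI_nat[of "\<lambda>k. up_ring.coeff P p k \<notin> K", OF n] bnd by blast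
  moreover have "k \<le> ?n" if "up_ring.coeff P p k \<notin> K" for k
    using Greatest_le_nat[of "\<lambda>k. up_ring.coeff P p k \<notin> K", OF that] bnd by blast
  ultimately show ?thesis by (metis not_le)
qed

text \<open>Multiplying by a polynomial that is monic of degree \<open>d\<close> raises the degree
  modulo \<open>K\<close> by exactly \<open>d\<close>, for any ideal \<open>K\<close>. As
  \<open>d > 0\<close>, a product \<open>f q\<close> can be constant modulo \<open>K\<close> only if
  \<open>q\<close> vanishes modulo \<open>K\<close>; then so does the constant. Primality of
  \<open>K\<close> does not enter, so powers of a maximal ideal are allowed.\<close>

lemma const_mem_of_mod_monic:
  assumes K: "ideal K R" and f: "f \<in> carrier P" "up_ring.coeff P f d = \<one>" "\<And>k. k > d \<Longrightarrow> up_ring.coeff P f k = \<zero>" "d > 0"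
    and a: "a \<in> carrier R" and q: "q \<in> carrier P"
    and mem: "up_ring.monom P a 0 \<ominus>\<^bsub>P\<^esub> f \<otimes>\<^bsub>P\<^esub> q \<in> coeffs_in R K"
  shows "a \<in> K"
proof -
  interpret K: ideal K R by fact
  have fq: "f \<otimes>\<^bsub>P\<^esub> q \<in> carrier P" using f q by simp
  have c: "up_ring.coeff P (up_ring.monom P a 0) n \<ominus> up_ring.coeff P (f \<otimes>\<^bsub>P\<^esub> q) n \<in> K" for n
    using mem a fq by (simp add: mem_coeffs_in del: coeff_mult)
  have "q \<in> coeffs_in R K"
  proof (rule ccontr)
    assume "q \<notin> coeffs_in R K"
    then obtain n where n: "up_ring.coeff P q n \<notin> K" "\<And>k. k > n \<Longrightarrow> up_ring.coeff P q k \<in> K"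
      using ex_top_coeff_not_in[OF q] K.zero_closed by blast
    \<comment> \<open>The index \<open>n + d\<close> is positive, so the constant polynomial
      contributes 0 there.\<close>
    have "\<ominus> up_ring.coeff P (f \<otimes>\<^bsub>P\<^esub> q) (n + d) \<in> K"
      using c[of "n + d"] a fq f(4) by (simp add: R.minus_eq del: coeff_mult)
    then have "\<ominus> (\<ominus> up_ring.coeff P (f \<otimes>\<^bsub>P\<^esub> q) (n + d)) \<in> K" by (rule K.a_inv_closed)
    then have s: "up_ring.coeff P (f \<otimes>\<^bsub>P\<^esub> q) (n + d) \<in> K" using fq coeff_closed R.minus_minus by metis
    let ?g = "\<lambda>i. up_ring.coeff P f i \<otimes> up_ring.coeff P q (n + d - i)"
    have S: "{..n + d} = insert d ({..n + d} - {d})" by auto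
    have "up_ring.coeff P (f \<otimes>\<^bsub>P\<^esub> q) (n + d) = (\<Oplus>i\<in>{..n + d}. ?g i)" using f q by simp
    also have "\<dots> = (\<Oplus>i\<in>insert d ({..n + d} - {d}). ?g i)" using S by simp
    also have "\<dots> = ?g d \<oplus> (\<Oplus>i\<in>{..n + d} - {d}. ?g i)"
      using f q by (intro R.finsum_insert) auto
    also have "?g d = up_ring.coeff P q n" using f q by simp
    finally have eq: "up_ring.coeff P (f \<otimes>\<^bsub>P\<^esub> q) (n + d) = up_ring.coeff P q n \<oplus> (\<Oplus>i\<in>{..n + d} - {d}. ?g i)" .
    have r: "(\<Oplus>i\<in>{..n + d} - {d}. ?g i) \<in> K"
    proof (rule K.finsum_mem)
      fix i assume i: "i \<in> {..n + d} - {d}"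
      show "?g i \<in> K"
      \<comment> \<open>Below \<open>d\<close> the factor from \<open>q\<close> has index above
        \<open>n\<close> and lies in \<open>K\<close>; above \<open>d\<close> the coefficient of
        \<open>f\<close> is 0.\<close>
      proof (cases "i < d")
        case True
        then show ?thesis using n(2)[of "n + d - i"] f by (intro K.I_l_closed) auto
      next
        case False
        then show ?thesis using i f(3)[of i] q by simp
      qed
    qed
    show False using K.mem_of_add_mem[OF coeff_closed[OF q] r] s n(1) unfolding eq by blast
  qed
  then have "up_ring.coeff P (f \<otimes>\<^bsub>P\<^esub> q) 0 \<in> K"
    using ideal.I_l_closed[OF coeffs_in_ideal[OF K]] f(1) mem_coeffs_in by blast
  then have "\<ominus> up_ring.coeff P (f \<otimes>\<^bsub>P\<^esub> q) 0 \<in> K" by (rule K.a_inv_closed)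
  moreover have "a \<oplus> \<ominus> up_ring.coeff P (f \<otimes>\<^bsub>P\<^esub> q) 0 \<in> K"
    using c[of 0] a by (simp add: R.minus_eq del: coeff_mult)
  ultimately show ?thesis using K.mem_of_add_mem[OF a] by blast
qed

text \<open>The ideal \<open>(f) + K[X]\<close> has its \<open>t\<close>-th power inside
  \<open>(f) + (K^t)[X]\<close>, because every mixed term of an expanded product contains a factor
  \<open>f\<close>.\<close>

lemma ideal_pow_mod_principal:
  assumes A: "ideal A P" and K: "ideal K R" and f: "f \<in> carrier P"
    and mod: "\<And>g. g \<in> A \<Longrightarrow> \<exists>q\<in>carrier P. g \<ominus>\<^bsub>P\<^esub> f \<otimes>\<^bsub>P\<^esub> q \<in> coeffs_in R K"
    and "g \<in> ideal_pow P A t"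
  shows "\<exists>q\<in>carrier P. g \<ominus>\<^bsub>P\<^esub> f \<otimes>\<^bsub>P\<^esub> q \<in> coeffs_in R (ideal_pow R K t)"
  using assms(5)
proof (induction t arbitrary: g)
  case 0
  then have g: "g \<in> carrier P" by (simp add: ideal_pow_0)
  then have "g \<ominus>\<^bsub>P\<^esub> f \<otimes>\<^bsub>P\<^esub> \<zero>\<^bsub>P\<^esub> \<in> coeffs_in R (ideal_pow R K 0)"
    using f by (simp add: mem_coeffs_in ideal_pow_0 del: coeff_mult)
  then show ?case by blast
next
  case (Suc t)
  have Kt: "ideal (ideal_pow R K t) R" using R.ideal_ideal_pow[OF K] .
  have carr: "x \<in> carrier P" if "x \<in> ideal_pow P A t \<or> x \<in> A \<or> x \<in> ideal_prod P (ideal_pow P A t) A" for x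
    using that ideal.Icarr[OF P.ideal_ideal_pow[OF A, of t]] ideal.Icarr[OF A]
      P.ideal_prod_in_carrier[OF P.ideal_ideal_pow[OF A, of t] A] by blast
  interpret L: ideal "coeffs_in R (ideal_prod R (ideal_pow R K t) K)" P
    using coeffs_in_ideal R.ideal_prod_is_ideal[OF Kt K] .
  from Suc.prems[unfolded ideal_pow_Suc] show ?case unfolding ideal_pow_Suc
  proof (induction rule: ideal_prod.induct)
    case (prod x y)
    obtain q where q: "q \<in> carrier P" "x \<ominus>\<^bsub>P\<^esub> f \<otimes>\<^bsub>P\<^esub> q \<in> coeffs_in R (ideal_pow R K t)"
      using Suc.IH[OF prod(1)] by blast
    obtain r where r: "r \<in> carrier P" "y \<ominus>\<^bsub>P\<^esub> f \<otimes>\<^bsub>P\<^esub> r \<in> coeffs_in R K"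
      using mod[OF prod(2)] by blast
    have xy: "x \<in> carrier P" "y \<in> carrier P" using prod carr by auto
    \<comment> \<open>The product of the two remainders has coefficients in \<open>K^t K\<close>,
      and it differs from \<open>x y\<close> by the displayed multiple of \<open>f\<close>.\<close>
    have "(x \<ominus>\<^bsub>P\<^esub> f \<otimes>\<^bsub>P\<^esub> q) \<otimes>\<^bsub>P\<^esub> (y \<ominus>\<^bsub>P\<^esub> f \<otimes>\<^bsub>P\<^esub> r)
       = x \<otimes>\<^bsub>P\<^esub> y \<ominus>\<^bsub>P\<^esub> f \<otimes>\<^bsub>P\<^esub> (x \<otimes>\<^bsub>P\<^esub> r \<oplus>\<^bsub>P\<^esub> q \<otimes>\<^bsub>P\<^esub> (y \<ominus>\<^bsub>P\<^esub> f \<otimes>\<^bsub>P\<^esub> r))"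
      using xy q(1) r(1) f by algebra
    moreover have "x \<otimes>\<^bsub>P\<^esub> r \<oplus>\<^bsub>P\<^esub> q \<otimes>\<^bsub>P\<^esub> (y \<ominus>\<^bsub>P\<^esub> f \<otimes>\<^bsub>P\<^esub> r) \<in> carrier P"
      using xy q(1) r(1) f by simp
    ultimately show ?case using mult_mem_coeffs_in_ideal_prod[OF Kt K q(2) r(2)] by metis
  next
    case (sum x y)
    obtain q where q: "q \<in> carrier P"
      "x \<ominus>\<^bsub>P\<^esub> f \<otimes>\<^bsub>P\<^esub> q \<in> coeffs_in R (ideal_prod R (ideal_pow R K t) K)"
      using sum.IH(1) by blast
    obtain r where r: "r \<in> carrier P"
      "y \<ominus>\<^bsub>P\<^esub> f \<otimes>\<^bsub>P\<^esub> r \<in> coeffs_in R (ideal_prod R (ideal_pow R K t) K)"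
      using sum.IH(2) by blast
    have xy: "x \<in> carrier P" "y \<in> carrier P" using sum carr by auto
    have "(x \<oplus>\<^bsub>P\<^esub> y) \<ominus>\<^bsub>P\<^esub> f \<otimes>\<^bsub>P\<^esub> (q \<oplus>\<^bsub>P\<^esub> r) = (x \<ominus>\<^bsub>P\<^esub> f \<otimes>\<^bsub>P\<^esub> q) \<oplus>\<^bsub>P\<^esub> (y \<ominus>\<^bsub>P\<^esub> f \<otimes>\<^bsub>P\<^esub> r)"
      using xy q(1) r(1) f by algebra
    also have "\<dots> \<in> coeffs_in R (ideal_prod R (ideal_pow R K t) K)"
      using q(2) r(2) by (rule L.a_closed)
    finally show ?case using q(1) r(1) P.a_closed by blast
  qed
qed

text \<open>Over the field \<open>R/M\<close> the image of \<open>A\<close> is a principal ideal,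
  and \<open>f\<close> is a monic lift of a generator. Properness of \<open>A\<close> excludes
  degree 0. The proof stays in \<open>R[X]\<close> and replaces the degree over \<open>R/M\<close>
  by the predicate \<open>top\<close>.\<close>

lemma proper_ideal_mod_maximal_le_monic:
  assumes M: "maximalideal M R" and A: "ideal A P" "coeffs_in R M \<subseteq> A" "\<one>\<^bsub>P\<^esub> \<notin> A"
  shows "\<exists>f\<in>carrier P. \<exists>d>0. up_ring.coeff P f d = \<one> \<and> (\<forall>k>d. up_ring.coeff P f k = \<zero>) \<and>
    (\<forall>g\<in>A. \<exists>q\<in>carrier P. g \<ominus>\<^bsub>P\<^esub> f \<otimes>\<^bsub>P\<^esub> q \<in> coeffs_in R M)"
proof -
  interpret M: maximalideal M R by fact
  interpret A: ideal A P by fact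
  define top where "top g n \<longleftrightarrow> up_ring.coeff P g n \<notin> M \<and> (\<forall>k>n. up_ring.coeff P g k \<in> M)" for g n
  have ex_top: "\<exists>n. top g n" if "g \<in> A" "g \<notin> coeffs_in R M" for g
    using ex_top_coeff_not_in[OF _ that(2) M.zero_closed] A.Icarr[OF that(1)] unfolding top_def by blast
  show ?thesis
  proof (cases "A \<subseteq> coeffs_in R M")
    case True
    \<comment> \<open>The image of \<open>A\<close> is zero here, so \<open>f = X\<close> with
      quotient 0 will do.\<close>
    have "g \<ominus>\<^bsub>P\<^esub> up_ring.monom P \<one> 1 \<otimes>\<^bsub>P\<^esub> \<zero>\<^bsub>P\<^esub> \<in> coeffs_in R M" if "g \<in> A" for g
    proof -
      have "g \<ominus>\<^bsub>P\<^esub> up_ring.monom P \<one> 1 \<otimes>\<^bsub>P\<^esub> \<zero>\<^bsub>P\<^esub> = g"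
        using A.Icarr[OF that] by (simp add: P.minus_eq)
      then show ?thesis using that True by auto
    qed
    then show ?thesis
      by (intro bexI[of _ "up_ring.monom P \<one> 1"] exI[of _ 1] conjI ballI bexI[of _ "\<zero>\<^bsub>P\<^esub>"]) simp_all
  next
    case False
    then have ex: "\<exists>n. \<exists>g\<in>A. top g n" using ex_top by blast
    define d where "d = (LEAST n. \<exists>g\<in>A. top g n)"
    obtain g where g: "g \<in> A" "top g d"
      using LeastI_ex[OF ex] unfolding d_def by blast
    have least: "d \<le> n" if "h \<in> A" "top h n" for h n
      unfolding d_def using that by (intro Least_le) blast
    have gP: "g \<in> carrier P" using g(1) A.Icarr by blast
    obtain v where v: "v \<in> carrier R" "v \<otimes> up_ring.coeff P g d \<ominus> \<one> \<in> M"
      using R.inverse_mod_maximalideal[OF M coeff_closed[OF gP]] g(2) unfolding top_def by blast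
    \<comment> \<open>These are the coefficients of \<open>v g\<close> with the one at
      \<open>d\<close> replaced by 1 and the higher ones by 0. Only elements of \<open>M\<close> are
      subtracted, so the resulting polynomial is still in \<open>A\<close> but truly monic of degree
      \<open>d\<close>.\<close>
    define h where "h n = (if n < d then v \<otimes> up_ring.coeff P g n else if n = d then \<one> else \<zero>)" for n
    have "\<exists>f\<in>carrier P. \<forall>n. up_ring.coeff P f n = h n"
      using v(1) gP by (intro ex_poly_coeffs[of h d]) (simp_all add: h_def)
    then obtain f where f: "f \<in> carrier P" "\<And>n. up_ring.coeff P f n = h n" by blast
    have vg: "v \<odot>\<^bsub>P\<^esub> g \<in> carrier P" using v(1) gP by simp
    have "v \<odot>\<^bsub>P\<^esub> g \<ominus>\<^bsub>P\<^esub> f \<in> coeffs_in R M"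
    proof -
      have "v \<otimes> up_ring.coeff P g n \<ominus> h n \<in> M" for n
      proof (cases n d rule: linorder_cases)
        case less
        then show ?thesis using v(1) gP by (simp add: h_def R.minus_eq R.r_neg)
      next
        case equal
        then show ?thesis using v(2) by (simp add: h_def)
      next
        case greater
        then have "up_ring.coeff P g n \<in> M" using g(2) by (simp add: top_def)
        then have "v \<otimes> up_ring.coeff P g n \<in> M" using v(1) by (rule M.I_l_closed)
        then show ?thesis using greater M.Icarr by (simp add: h_def R.minus_eq)
      qed
      then show ?thesis using v(1) gP vg f by (simp add: mem_coeffs_in)
    qed
    then have "v \<odot>\<^bsub>P\<^esub> g \<ominus>\<^bsub>P\<^esub> f \<in> A" using A(2) by blast
    moreover have "v \<odot>\<^bsub>P\<^esub> g = up_ring.monom P v 0 \<otimes>\<^bsub>P\<^esub> g"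
      using v(1) gP by (simp add: monom_mult_is_smult)
    then have "v \<odot>\<^bsub>P\<^esub> g \<in> A" using v(1) g(1) by (simp add: A.I_l_closed)
    then have "\<ominus>\<^bsub>P\<^esub> (v \<odot>\<^bsub>P\<^esub> g) \<in> A" by (rule A.a_inv_closed)
    moreover have "\<ominus>\<^bsub>P\<^esub> f = v \<odot>\<^bsub>P\<^esub> g \<ominus>\<^bsub>P\<^esub> f \<oplus>\<^bsub>P\<^esub> \<ominus>\<^bsub>P\<^esub> (v \<odot>\<^bsub>P\<^esub> g)"
      using vg f(1) by algebra
    ultimately have "\<ominus>\<^bsub>P\<^esub> f \<in> A" by (metis A.a_closed)
    then have "\<ominus>\<^bsub>P\<^esub> (\<ominus>\<^bsub>P\<^esub> f) \<in> A" by (rule A.a_inv_closed)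
    then have fA: "f \<in> A" using f(1) by simp
    have one: "\<one> \<noteq> \<zero>" using M.I_notcarr M.one_imp_carrier M.zero_closed by metis
    have deg: "deg R f = d"
      using f one by (intro le_antisym deg_aboveI deg_belowI) (simp_all add: h_def)
    have "d > 0"
    proof (rule ccontr)
      assume "\<not> d > 0"
      then have "f = \<one>\<^bsub>P\<^esub>" using f by (intro up_eqI) (auto simp: h_def)
      then show False using fA A(3) by simp
    qed
    moreover have "\<exists>q\<in>carrier P. p \<ominus>\<^bsub>P\<^esub> f \<otimes>\<^bsub>P\<^esub> q \<in> coeffs_in R M" if p: "p \<in> A" for p
    proof -
      have pP: "p \<in> carrier P" using p A.Icarr by blast
      have "f \<noteq> \<zero>\<^bsub>P\<^esub>" using fA f(2)[of d] one by (auto simp: h_def)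
      then obtain q r k where q: "q \<in> carrier P" "r \<in> carrier P"
        "up_ring.coeff P f (deg R f) [^] (k::nat) \<odot>\<^bsub>P\<^esub> p = f \<otimes>\<^bsub>P\<^esub> q \<oplus>\<^bsub>P\<^esub> r"
        "r = \<zero>\<^bsub>P\<^esub> \<or> deg R r < deg R f"
        using long_div_theorem[OF f(1) pP] by blast
      \<comment> \<open>Pseudo-division scales \<open>p\<close> by a power of the leading
        coefficient of \<open>f\<close>, which is 1.\<close>
      have "p = f \<otimes>\<^bsub>P\<^esub> q \<oplus>\<^bsub>P\<^esub> r" using q(3) pP by (simp add: deg f(2) h_def)
      then have r: "p \<ominus>\<^bsub>P\<^esub> f \<otimes>\<^bsub>P\<^esub> q = r" using f(1) q(1,2) by simp algebra
      have "f \<otimes>\<^bsub>P\<^esub> q \<in> A" using fA q(1) by (rule A.I_r_closed)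
      then have "r \<in> A" using p r A.a_inv_closed A.a_closed unfolding P.minus_eq by metis
      \<comment> \<open>The remainder lies in \<open>A\<close> and has degree below \<open>d\<close>
        or is zero; were it nonzero modulo \<open>M\<close>, its degree modulo \<open>M\<close>
        would contradict the minimality of \<open>d\<close>.\<close>
      have "r \<in> coeffs_in R M"
      proof (rule ccontr)
        assume nr: "r \<notin> coeffs_in R M"
        then obtain n where n: "top r n" using ex_top \<open>r \<in> A\<close> by blast
        have "r \<noteq> \<zero>\<^bsub>P\<^esub>" using nr by (auto simp: mem_coeffs_in)
        then have "deg R r < n" using q(4) least[OF \<open>r \<in> A\<close> n] deg by auto
        then have "up_ring.coeff P r n = \<zero>" using deg_aboveD q(2) by blast
        then show False using n by (simp add: top_def)
      qed
      then show ?thesis using q(1) r by metis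
    qed
    ultimately show ?thesis using f by (intro bexI[of _ f] exI[of _ d]) (auto simp: h_def)
  qed
qed

section \<open>Contraction to the constants\<close>

lemma const_ring_hom_ring: "ring_hom_ring R P (\<lambda>a. up_ring.monom P a 0)"
  by (rule ring_hom_ringI2[OF R.ring_axioms P.ring_axioms const_ring_hom])

lemma mem_contraction: "a \<in> contraction R A \<longleftrightarrow> a \<in> carrier R \<and> up_ring.monom P a 0 \<in> A"
  unfolding contraction_def P_def by simp

lemma contraction_ideal:
  assumes "ideal A P"
  shows "ideal (contraction R A) R"
  using ring_hom_ring.ideal_vimage[OF const_ring_hom_ring assms]
  unfolding contraction_def P_def .

text \<open>A polynomial is the sum of its terms, each being a power of \<open>X\<close> times a
  constant that lies in \<open>A\<close>.\<close>

lemma coeffs_in_contraction_subset: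
  assumes "ideal A P"
  shows "coeffs_in R (contraction R A) \<subseteq> A"
proof
  interpret A: ideal A P by fact
  fix p assume "p \<in> coeffs_in R (contraction R A)"
  then have p: "p \<in> carrier P" "\<And>n. up_ring.coeff P p n \<in> carrier R"
    "\<And>n. up_ring.monom P (up_ring.coeff P p n) 0 \<in> A"
    by (auto simp: mem_coeffs_in mem_contraction)
  have "up_ring.monom P (up_ring.coeff P p n) n \<in> A" for n
  proof -
    have "up_ring.monom P (up_ring.coeff P p n) 0 \<otimes>\<^bsub>P\<^esub> up_ring.monom P \<one> n \<in> A"
      using p(3) by (rule A.I_r_closed) simp
    then show ?thesis using monom_mult[OF p(2)[of n] R.one_closed, of 0 n] p(2) by simp
  qed
  then have "(\<Oplus>\<^bsub>P\<^esub>i\<in>{..deg R p}. up_ring.monom P (up_ring.coeff P p i) i) \<in> A"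
    by (rule A.finsum_mem)
  then show "p \<in> A" using up_repr[OF p(1)] by simp
qed

lemma contraction_radical_ideal:
  assumes "radical_ideal A P"
  shows "radical_ideal (contraction R A) R"
proof -
  have A: "ideal A P" "ideal_radical P A = A" using assms by (auto simp: radical_ideal_def)
  interpret J: ideal "contraction R A" R using contraction_ideal[OF A(1)] .
  have "x \<in> contraction R A" if x: "x \<in> carrier R" "n \<ge> 1" "x [^] n \<in> contraction R A" for x and n :: nat
  proof -
    have "up_ring.monom P x 0 [^]\<^bsub>P\<^esub> n \<in> A"
      using x(3) monom_pow[OF x(1), of 0 n] unfolding mem_contraction by simp
    then have "up_ring.monom P x 0 \<in> ideal_radical P A"
      using x(1,2) monom_closed[OF x(1), of 0] unfolding ideal_radical_def by blast
    then have "up_ring.monom P x 0 \<in> A" unfolding A(2) .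
    with x(1) show ?thesis unfolding mem_contraction ..
  qed
  moreover have "x \<in> ideal_radical R (contraction R A)" if "x \<in> contraction R A" for x
  proof -
    have "x [^] (1::nat) \<in> contraction R A" using that J.Icarr by simp
    then show ?thesis unfolding ideal_radical_def using J.Icarr[OF that] by blast
  qed
  ultimately have "ideal_radical R (contraction R A) = contraction R A"
    unfolding ideal_radical_def by blast
  then show ?thesis unfolding radical_ideal_def using J.is_ideal by blast
qed

text \<open>This is the easy inclusion of power stability, valid for every ideal: products and sums
  of constants are formed in the same way in \<open>R\<close> and in \<open>R[X]\<close>.\<close>

lemma ideal_pow_contraction_subset:
  assumes A: "ideal A P"
  shows "ideal_pow R (contraction R A) t \<subseteq> contraction R (ideal_pow P A t)"
proof (induction t)
  case 0
  then show ?case by (auto simp: ideal_pow_0 mem_contraction)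
next
  case (Suc t)
  interpret J: ideal "contraction R (ideal_prod P (ideal_pow P A t) A)" R
    by (rule contraction_ideal[OF P.ideal_prod_is_ideal[OF P.ideal_ideal_pow[OF A] A]])
  show ?case unfolding ideal_pow_Suc
  proof
    fix x assume "x \<in> ideal_prod R (ideal_pow R (contraction R A) t) (contraction R A)"
    then show "x \<in> contraction R (ideal_prod P (ideal_pow P A t) A)"
    proof (induction rule: ideal_prod.induct)
      case (prod i j)
      then have i: "i \<in> carrier R" "up_ring.monom P i 0 \<in> ideal_pow P A t"
        using Suc.IH by (auto simp: mem_contraction)
      have j: "j \<in> carrier R" "up_ring.monom P j 0 \<in> A"
        using prod(2) by (auto simp: mem_contraction)
      have "up_ring.monom P (i \<otimes> j) 0 = up_ring.monom P i 0 \<otimes>\<^bsub>P\<^esub> up_ring.monom P j 0"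
        using monom_mult[OF i(1) j(1), of 0 0] by simp
      also have "\<dots> \<in> ideal_prod P (ideal_pow P A t) A" using i(2) j(2) by (rule ideal_prod.prod)
      finally show ?case using i(1) j(1) by (simp add: mem_contraction)
    next
      case (sum x y)
      from sum(3,4) show ?case by (rule J.a_closed)
    qed
  qed
qed

text \<open>The multiplier \<open>b\<close> keeps \<open>A + M[X]\<close> proper, so modulo
  \<open>M\<close> the ideal \<open>A\<close> consists of multiples of one monic \<open>f\<close> of
  positive degree. A constant of \<open>A^t\<close> is then a multiple of \<open>f\<close> modulo
  \<open>(M^t)[X]\<close>, which forces it into \<open>M^t\<close>.\<close>

lemma contraction_ideal_pow_subset_at:
  assumes M: "maximalideal M R" and A: "ideal A P"
    and b: "b \<in> carrier R - M" "\<And>x. x \<in> M \<Longrightarrow> b \<otimes> x \<in> contraction R A"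
    and J: "contraction R A \<subseteq> M"
  shows "contraction R (ideal_pow P A t) \<subseteq> ideal_pow R M t"
proof
  fix a assume "a \<in> contraction R (ideal_pow P A t)"
  then have a: "a \<in> carrier R" "up_ring.monom P a 0 \<in> ideal_pow P A t"
    by (auto simp: mem_contraction)
  interpret M: maximalideal M R by fact
  interpret A: ideal A P by fact
  interpret MX: ideal "coeffs_in R M" P using coeffs_in_ideal[OF M.is_ideal] .
  let ?B = "A <+>\<^bsub>P\<^esub> coeffs_in R M"
  have "\<one>\<^bsub>P\<^esub> \<notin> ?B"
  proof
    assume "\<one>\<^bsub>P\<^esub> \<in> ?B"
    then obtain g p where gp: "g \<in> A" "p \<in> coeffs_in R M" "\<one>\<^bsub>P\<^esub> = g \<oplus>\<^bsub>P\<^esub> p"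
      unfolding set_add_def' by auto
    have gP: "g \<in> carrier P" "p \<in> carrier P" using gp A.Icarr MX.Icarr by auto
    have bP: "up_ring.monom P b 0 \<in> carrier P" using b(1) by simp
    \<comment> \<open>Multiplying \<open>1 = g + p\<close> by \<open>b\<close> gives
      \<open>b = b g + b p\<close>. Both terms lie in \<open>A\<close>, so \<open>b\<close> would be
      in the contraction and hence in \<open>M\<close>.\<close>
    have "b \<odot>\<^bsub>P\<^esub> p \<in> coeffs_in R (contraction R A)"
      using b gp(2) by (simp add: mem_coeffs_in)
    then have "up_ring.monom P b 0 \<otimes>\<^bsub>P\<^esub> p \<in> coeffs_in R (contraction R A)"
      using b(1) gP(2) by (simp add: monom_mult_is_smult)
    then have "up_ring.monom P b 0 \<otimes>\<^bsub>P\<^esub> p \<in> A" using coeffs_in_contraction_subset[OF A] by blast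
    moreover have "up_ring.monom P b 0 \<otimes>\<^bsub>P\<^esub> g \<in> A" using gp(1) bP by (rule A.I_l_closed)
    ultimately have "up_ring.monom P b 0 \<otimes>\<^bsub>P\<^esub> g \<oplus>\<^bsub>P\<^esub> up_ring.monom P b 0 \<otimes>\<^bsub>P\<^esub> p \<in> A"
      by (rule A.a_closed[rotated])
    moreover have "up_ring.monom P b 0 = up_ring.monom P b 0 \<otimes>\<^bsub>P\<^esub> (g \<oplus>\<^bsub>P\<^esub> p)"
      using bP unfolding gp(3)[symmetric] by simp
    then have "up_ring.monom P b 0 = up_ring.monom P b 0 \<otimes>\<^bsub>P\<^esub> g \<oplus>\<^bsub>P\<^esub> up_ring.monom P b 0 \<otimes>\<^bsub>P\<^esub> p"
      using bP gP by (simp add: P.r_distr)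
    ultimately have "up_ring.monom P b 0 \<in> A" by simp
    then show False using b(1) J by (auto simp: mem_contraction)
  qed
  have AB: "A \<subseteq> ?B" "coeffs_in R M \<subseteq> ?B"
    using P.ideals_subset_set_add[OF A MX.is_ideal] by auto
  obtain f d where f: "f \<in> carrier P" "d > 0" "up_ring.coeff P f d = \<one>" "\<And>k. k > d \<Longrightarrow> up_ring.coeff P f k = \<zero>"
    "\<And>g. g \<in> ?B \<Longrightarrow> \<exists>q\<in>carrier P. g \<ominus>\<^bsub>P\<^esub> f \<otimes>\<^bsub>P\<^esub> q \<in> coeffs_in R M"
    using proper_ideal_mod_maximal_le_monic[OF M P.add_ideals[OF A MX.is_ideal] AB(2) \<open>\<one>\<^bsub>P\<^esub> \<notin> ?B\<close>] by blast
  obtain q where q: "q \<in> carrier P"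
    "up_ring.monom P a 0 \<ominus>\<^bsub>P\<^esub> f \<otimes>\<^bsub>P\<^esub> q \<in> coeffs_in R (ideal_pow R M t)"
    using ideal_pow_mod_principal[OF A M.is_ideal f(1) f(5) a(2)] AB(1) by blast
  show "a \<in> ideal_pow R M t"
    by (rule const_mem_of_mod_monic[OF R.ideal_ideal_pow[OF M.is_ideal] f(1,3,4,2) a(1) q])
qed

end


section \<open>From maximal ideals to the whole ring\<close>

theorem theorem3p15:
  fixes R :: "('a, 'b) ring_scheme"
    and I :: "(nat \<Rightarrow> 'a) set"
  assumes "noetherian_domain R"
    and "krull_dim R = 1"
    and "radical_ideal I (UP R)"
  shows "power_stable R I"
proof -
  interpret R: noetherian_domain R by fact
  interpret UP_cring R "UP R" by unfold_locales auto
  have I: "ideal I (UP R)" using assms(3) by (simp add: radical_ideal_def)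
  let ?J = "contraction R I"
  have J: "ideal ?J R" using contraction_ideal[OF I] .
  have "contraction R (ideal_pow (UP R) I t) \<subseteq> ideal_pow R ?J t" if t: "t \<ge> 1" for t
  proof
    fix a assume a: "a \<in> contraction R (ideal_pow (UP R) I t)"
    then have aR: "a \<in> carrier R" by (simp add: contraction_def)
    interpret Jt: ideal "ideal_pow R ?J t" R using R.ideal_ideal_pow[OF J] .
    show "a \<in> ideal_pow R ?J t"
    proof (cases "?J = {\<zero>\<^bsub>R\<^esub>}")
      case True
      \<comment> \<open>As \<open>t\<close> is at least 1, the \<open>t\<close>-th power of
        \<open>I\<close> is inside \<open>I\<close>, so \<open>a\<close> is 0.\<close>
      have "a \<in> ?J"
        using a P.ideal_pow_subset[OF I t] by (auto simp: contraction_def)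
      then show ?thesis using True Jt.zero_closed by simp
    next
      case False
      let ?C = "{x \<in> carrier R. a \<otimes>\<^bsub>R\<^esub> x \<in> ideal_pow R ?J t}"
      have C: "ideal ?C R" using R.colon_ideal[OF Jt.is_ideal aR] .
      have "?C = carrier R"
      proof (rule ccontr)
        assume "?C \<noteq> carrier R"
        then obtain M where M: "maximalideal M R" "?C \<subseteq> M"
          using R.exists_maximalideal_above[OF C] by blast
        interpret M: primeideal M R using R.maximalideal_prime[OF M(1)] .
        have "?J \<subseteq> M"
        proof
          \<comment> \<open>From \<open>x^t\<close> in \<open>?J^t\<close> it follows that
            \<open>x^t\<close> is in \<open>?C\<close>, hence in the prime ideal
            \<open>M\<close>.\<close>
          fix x assume x: "x \<in> ?J"
          then have xR: "x \<in> carrier R" by (simp add: contraction_def)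
          have "x [^]\<^bsub>R\<^esub> t \<in> ideal_pow R ?J t" using nat_pow_mem_ideal_pow[OF R.monoid_axioms x]
            ideal.Icarr[OF J] by blast
          then have "x [^]\<^bsub>R\<^esub> t \<in> M" using M(2) xR aR Jt.I_l_closed by auto
          then show "x \<in> M" using M.nat_pow_memD[OF xR] by blast
        qed
        then obtain b where b: "b \<in> carrier R - M" "\<And>x. x \<in> M \<Longrightarrow> b \<otimes>\<^bsub>R\<^esub> x \<in> ?J"
          using R.radical_ideal_locally_maximal[OF _ contraction_radical_ideal[OF assms(3)] False _ M.primeideal]
            assms(2) by auto
        have "a \<in> ideal_pow R M t"
          using contraction_ideal_pow_subset_at[OF M(1) I b \<open>?J \<subseteq> M\<close>] a by blast
        \<comment> \<open>Since \<open>b\<close> sends \<open>M\<close> into \<open>?J\<close>, its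
          \<open>t\<close>-th power sends \<open>M^t\<close> into \<open>?J^t\<close>. This puts
          \<open>b^t\<close> into \<open>?C\<close>, so \<open>b\<close> would lie in
          \<open>M\<close>.\<close>
        then have "b [^]\<^bsub>R\<^esub> t \<otimes>\<^bsub>R\<^esub> a \<in> ideal_pow R ?J t"
          using b by (intro R.ideal_pow_scale[OF M.is_ideal _ J]) auto
        then have "b [^]\<^bsub>R\<^esub> t \<in> M" using M(2) b(1) aR R.m_comm by auto
        then show False using M.nat_pow_memD b(1) by blast
      qed
      then have "\<one>\<^bsub>R\<^esub> \<in> ?C" using R.one_closed by simp
      then show ?thesis using aR by simp
    qed
  qed
  then show ?thesis
    unfolding power_stable_def using I ideal_pow_contraction_subset[OF I] by blast
qed

end
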